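(* Let $G$ be an arbitrary graph (not necessarily a tree), and let $v$ be an arbitrary vertex of $G$. For $n\ge 1$, let $G^1_n$ be obtained from $G$ by attaching a star with $n$ leaves to $G$ at $v$, with the center of the star as the point of attachment (i.e., by attaching $n$ pendant edges at $v$), and let $G^2_n$ be obtained from $G$ by attaching a star with $n$ leaves to $G$ at $v$, with one of the leaves of the star as the point of attachment (i.e., by attaching a pendant edge at $v$ to a new vertex $w$, and then attaching $n-1$ pendant edges at $w$). Then for all sufficiently large $n$ (how large depending on $G$), both $G^1_n$ and $G^2_n$ have log-concave (and hence unimodal) independent set sequence.
   Context: All graphs are simple, finite and loopless. Attaching $m$ pendant edges at a vertex $u$ means adding $m$ new vertices, each adjacent only to $u$. An independent set in a graph $H$ is a set of pairwise non-adjacent vertices; $i_H(t)$ is the number of independent sets of size $t$ in $H$, $\alpha(H)$ is the size of the largest independent set, and the independent set sequence of $H$ is $(i_H(t))_{t=0}^{\alpha(H)}$. A finite real sequence $(a_0,\dots,a_n)$ is log-concave if $a_k^2\ge a_{k-1}a_{k+1}$ for $k=1,\dots,n-1$, and unimodal if there is $m$, $0\le m\le n$, with $a_0\le a_1\le\dots\le a_m\ge a_{m+1}\ge\dots\ge a_n$. *)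

theory Defs
  imports Complex_Main "Graph_Theory.Pair_Digraph"
begin

text \<open>
  Finite simple graphs are modelled by the locale \<open>pair_graph\<close>: finite digraphs without
  loops or multiple arcs whose set of arcs is a symmetric set of pairs.
\<close>

text \<open>
  The new vertices are \<open>Inr 0, \<dots>, Inr (m - 1)\<close>; the vertices of the original graph are
  tagged with \<open>Inl\<close>.
\<close>

definition attach_pendants :: "'a pair_pre_digraph \<Rightarrow> 'a \<Rightarrow> nat \<Rightarrow> ('a + nat) pair_pre_digraph"
  where "attach_pendants G u m =
    \<lparr> pverts = Inl ` pverts G \<union> Inr ` {..<m},
      parcs = {(Inl x, Inl y) | x y. (x, y) \<in> parcs G}
        \<union> {(Inl u, Inr i) | i. i < m} \<union> {(Inr i, Inl u) | i. i < m} \<rparr>"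

lemma pair_graph_attach_pendants:
  assumes "pair_graph G" "u \<in> pverts G"
  shows "pair_graph (attach_pendants G u m)"
proof -
  interpret pair_graph G by fact
  have "finite {(Inl x, Inl y) :: ('a + nat) \<times> ('a + nat) | x y. (x, y) \<in> parcs G}"
    by (rule finite_subset[of _ "(\<lambda>(x, y). (Inl x, Inl y)) ` parcs G"]) auto
  moreover have "sym (parcs G)"
    using sym_arcs by (simp add: symmetric_def arcs_ends_def arc_to_ends_def)
  ultimately show ?thesis
    using assms(2)
    by unfold_locales
      (auto simp: attach_pendants_def symmetric_def arcs_ends_def arc_to_ends_def
        intro!: symI dest: in_arcsD1 in_arcsD2 no_loops' symD)
qed

definition attach_star_at_center ::
    "'a pair_pre_digraph \<Rightarrow> 'a \<Rightarrow> nat \<Rightarrow> ('a + nat) pair_pre_digraph"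
  where "attach_star_at_center G v n = attach_pendants G v n"

text \<open>
  The vertex \<open>Inr 0\<close> added in the first step is the center \<open>w\<close> of the star; the star has
  \<open>n \<ge> 1\<close> leaves, one of which is identified with \<open>v\<close>.
\<close>

definition attach_star_at_leaf ::
    "'a pair_pre_digraph \<Rightarrow> 'a \<Rightarrow> nat \<Rightarrow> (('a + nat) + nat) pair_pre_digraph"
  where "attach_star_at_leaf G v n = attach_pendants (attach_pendants G v 1) (Inr 0) (n - 1)"

definition independent_set :: "'a pair_pre_digraph \<Rightarrow> 'a set \<Rightarrow> bool"
  where "independent_set H S \<longleftrightarrow> S \<subseteq> pverts H \<and> (\<forall>x\<in>S. \<forall>y\<in>S. (x, y) \<notin> parcs H)"

definition num_independent_sets :: "'a pair_pre_digraph \<Rightarrow> nat \<Rightarrow> nat"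
  where "num_independent_sets H t = card {S. independent_set H S \<and> card S = t}"

definition independence_number :: "'a pair_pre_digraph \<Rightarrow> nat"
  where "independence_number H = Max (card ` {S. independent_set H S})"

text \<open>A finite sequence \<open>a 0, \<dots>, a n\<close> is given by a function and the index \<open>n\<close> of its last term.\<close>

definition log_concave_seq :: "(nat \<Rightarrow> real) \<Rightarrow> nat \<Rightarrow> bool"
  where "log_concave_seq a n \<longleftrightarrow>
    (\<forall>k. 1 \<le> k \<and> k < n \<longrightarrow> (a k)\<^sup>2 \<ge> a (k - 1) * a (k + 1))"

definition unimodal_seq :: "(nat \<Rightarrow> real) \<Rightarrow> nat \<Rightarrow> bool"
  where "unimodal_seq a n \<longleftrightarrow>
    (\<exists>m\<le>n. (\<forall>k<m. a k \<le> a (k + 1)) \<and> (\<forall>k. m \<le> k \<and> k < n \<longrightarrow> a k \<ge> a (k + 1)))"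

definition log_concave_independent_set_seq :: "'a pair_pre_digraph \<Rightarrow> bool"
  where "log_concave_independent_set_seq H \<longleftrightarrow>
    log_concave_seq (\<lambda>t. real (num_independent_sets H t)) (independence_number H)"

definition unimodal_independent_set_seq :: "'a pair_pre_digraph \<Rightarrow> bool"
  where "unimodal_independent_set_seq H \<longleftrightarrow>
    unimodal_seq (\<lambda>t. real (num_independent_sets H t)) (independence_number H)"

end

theory Submission
  imports Defs "HOL-Computational_Algebra.Polynomial"
begin

text \<open>
  Splitting the independent sets of \<open>H\<close> according to whether they contain \<open>u\<close>, attaching \<open>m\<close>
  pendant edges at \<open>u\<close> yields the independence polynomial \<open>A (1 + x)\<^sup>m + B\<close>, where \<open>A\<close> and \<open>B\<close>
  do not depend on \<open>m\<close>, \<open>A\<close> has nonnegative coefficients, \<open>A(0) = 1\<close> and \<open>B(0) = 0\<close>. Both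
  constructions of the theorem are of this kind; for the second one take \<open>H\<close> to be \<open>G\<close> with a
  single pendant edge at \<open>v\<close>, and \<open>u\<close> its new end.

  Let \<open>c\<^sub>k\<close> be the coefficients of such a polynomial and \<open>a\<close> the degree of \<open>A\<close>. For each fixed
  \<open>k\<close>, \<open>c\<^sub>k / m\<^sup>k\<close> tends to \<open>A(0) / k!\<close>, a strictly log-concave sequence, so the log-concavity
  inequality holds at \<open>k\<close> for large \<open>m\<close>; reversing \<open>A\<close> handles the indices at bounded distance
  from the top. At the remaining indices \<open>B\<close> does not contribute and, in the double sum over
  \<open>i, j \<le> a\<close> for \<open>c\<^sub>k\<^sup>2 - c\<^sub>k\<^sub>-\<^sub>1 c\<^sub>k\<^sub>+\<^sub>1\<close>, the terms of \<open>(i, j)\<close> and \<open>(j, i)\<close> together are nonnegative.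
\<close>

section \<open>Log-concavity of products with high powers of \<open>1 + x\<close>\<close>

lemma coeff_mult_linear_power:
  fixes A :: "'a::comm_semiring_1 poly"
  shows "coeff (A * [:1, 1:] ^ n) k = (\<Sum>i\<le>k. coeff A i * of_nat (n choose (k - i)))"
proof -
  have "coeff ([:1, 1:] ^ n) j = (of_nat (n choose j) :: 'a)" for j
  proof (cases "j \<le> n")
    case False
    then have "degree ([:1, 1:] ^ n :: 'a poly) < j"
      using degree_power_le[of "[:1, 1:] :: 'a poly" n] by simp
    with False show ?thesis
      by (simp add: coeff_eq_0 binomial_eq_0)
  qed (simp add: coeff_linear_poly_power)
  then show ?thesis
    by (simp add: coeff_mult)
qed

text \<open>Since the subtraction is real, \<open>k > n\<close> is covered too: both sides are then
  0.\<close>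

lemma choose_Suc_mult: "real (Suc k) * real (n choose Suc k) = (real n - real k) * real (n choose k)"
proof (cases "k \<le> n")
  case True
  have "Suc k * (n choose Suc k) = (n - k) * (n choose k)"
    by (metis binomial_absorb_comp binomial_absorption)
  with True show ?thesis
    by (metis of_nat_diff of_nat_mult)
qed (simp add: binomial_eq_0)

text \<open>For \<open>p + 1 < q\<close> log-concavity of a binomial row makes the second product at
  least the product of the entries at \<open>p\<close> and \<open>q\<close>, so the two products
  have to be bounded together. A distance \<open>m\<close> from both ends of the row, with
  \<open>m\<close> at least the squared gap, suffices.\<close>

lemma choose_cross_le:
  fixes n p q m :: nat
  assumes "(real p - real q)\<^sup>2 \<le> real m"
    and "m \<le> p" "m \<le> q" "p + m \<le> n" "q + m \<le> n" "1 \<le> p" "1 \<le> q"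
  shows "real (n choose (p - 1)) * real (n choose (q + 1)) + real (n choose (p + 1)) * real (n choose (q - 1))
    \<le> 2 * (real (n choose p) * real (n choose q))"
proof -
  define P Q R S N where "P = real p + 1" and "Q = real q + 1"
    and "R = real n - real p + 1" and "S = real n - real q + 1" and "N = real n + 2"
  note defs = P_def Q_def R_def S_def N_def
  have pos: "P > 0" "Q > 0" "R > 0" "S > 0" "N \<ge> 1"
    using assms by (auto simp: defs)
  have RS: "R = N - P" "S = N - Q"
    by (simp_all add: defs)
  \<comment> \<open>Since \<open>P + R = Q + S = N\<close>, the claim divided by the two binomial coefficients is equivalent to
    \<open>N (P - Q)\<^sup>2 \<le> P S + R Q\<close>.\<close>
  have "N * (P - Q)\<^sup>2 \<le> N * real m"
    using assms(1) pos by (intro mult_left_mono) (auto simp: defs)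
  also have "\<dots> = real m * S + real m * Q"
    by (simp add: RS algebra_simps)
  also have "\<dots> \<le> P * S + R * Q"
    using assms pos by (intro add_mono mult_right_mono) (auto simp: defs)
  finally have "0 \<le> (N - 1) * (P * S + R * Q - N * (P - Q)\<^sup>2)"
    using pos by simp
  also have "\<dots> = 2 * (P * Q * R * S) - (P * S * (P - 1) * (S - 1) + R * Q * (R - 1) * (Q - 1))"
    unfolding RS by (simp add: algebra_simps power2_eq_square)
  finally have "P * S * (P - 1) * (S - 1) + R * Q * (R - 1) * (Q - 1) \<le> 2 * (P * Q * R * S)"
    by simp
  then have ratio: "(P - 1) / R * ((S - 1) / Q) + (R - 1) / P * ((Q - 1) / S) \<le> 2"
    using pos by (simp add: field_simps)
  have up: "real (n choose (r + 1)) = real (n choose r) * ((real n - real r) / (real r + 1))" for r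
    using choose_Suc_mult[of r n] by (simp add: field_simps)
  have down: "real (n choose (r - 1)) = real (n choose r) * (real r / (real n - real r + 1))"
    if "1 \<le> r" "r \<le> n" for r
    using choose_Suc_mult[of "r - 1" n] that by (simp add: field_simps)
  have "real (n choose (p - 1)) = real (n choose p) * ((P - 1) / R)"
    "real (n choose (p + 1)) = real (n choose p) * ((R - 1) / P)"
    "real (n choose (q - 1)) = real (n choose q) * ((Q - 1) / S)"
    "real (n choose (q + 1)) = real (n choose q) * ((S - 1) / Q)"
    using assms up[of p] up[of q] down[of p] down[of q] by (simp_all add: defs)
  then have "real (n choose (p - 1)) * real (n choose (q + 1)) + real (n choose (p + 1)) * real (n choose (q - 1))
    = real (n choose p) * real (n choose q) * ((P - 1) / R * ((S - 1) / Q) + (R - 1) / P * ((Q - 1) / S))"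
    by (simp add: algebra_simps)
  also have "\<dots> \<le> real (n choose p) * real (n choose q) * 2"
    by (intro mult_left_mono ratio) auto
  finally show ?thesis
    by simp
qed

lemma log_concave_middle:
  fixes A :: "real poly"
  assumes nonneg: "\<And>i. coeff A i \<ge> 0"
    and "degree A * degree A + degree A + 1 \<le> k" "k + degree A * degree A \<le> n"
  shows "coeff (A * [:1, 1:] ^ n) (k - 1) * coeff (A * [:1, 1:] ^ n) (k + 1)
    \<le> (coeff (A * [:1, 1:] ^ n) k)\<^sup>2"
proof -
  define a where "a = degree A"
  define b where "b r = real (n choose r)" for r
  \<comment> \<open>Truncated subtraction would make \<open>b (l - i)\<close> equal to 1 for
    \<open>i > l\<close>, whence the restriction on \<open>l\<close>.\<close>
  have coeff: "coeff (A * [:1, 1:] ^ n) l = (\<Sum>i\<le>a. coeff A i * b (l - i))" if "a \<le> l" for l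
    unfolding coeff_mult_linear_power b_def using that
    by (intro sum.mono_neutral_right) (auto simp: a_def coeff_eq_0)
  let ?c = "coeff (A * [:1, 1:] ^ n)"
  have prod: "?c l * ?c l' = (\<Sum>i\<le>a. \<Sum>j\<le>a. coeff A i * coeff A j * (b (l - i) * b (l' - j)))"
    if "a \<le> l" "a \<le> l'" for l l'
    unfolding coeff[OF that(1)] coeff[OF that(2)] sum_product by (simp add: mult_ac)
  have swap: "(\<Sum>i\<le>a. \<Sum>j\<le>a. coeff A i * coeff A j * f i j)
    = (\<Sum>i\<le>a. \<Sum>j\<le>a. coeff A i * coeff A j * f j i)" for f
    by (subst sum.swap) (simp add: mult.commute)
  have a: "a + 1 \<le> k" "a * a + a + 1 \<le> k" "k + a * a \<le> n"
    using assms by (auto simp: a_def)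
  \<comment> \<open>Both orders of the factors are expanded, so that the \<open>(i, j)\<close> terms
    of the two sums form the left side of \<open>choose_cross_le\<close> with
    \<open>p = k - i\<close> and \<open>q = k - j\<close>.\<close>
  have "2 * (?c (k - 1) * ?c (k + 1)) =
    (\<Sum>i\<le>a. \<Sum>j\<le>a. coeff A i * coeff A j * (b (k - 1 - i) * b (k + 1 - j)))
    + (\<Sum>i\<le>a. \<Sum>j\<le>a. coeff A i * coeff A j * (b (k + 1 - i) * b (k - 1 - j)))"
    using prod[of "k - 1" "k + 1"] prod[of "k + 1" "k - 1"] a by (simp add: mult.commute)
  also have "\<dots> = (\<Sum>i\<le>a. \<Sum>j\<le>a. coeff A i * coeff A j *
      (b (k - 1 - i) * b (k + 1 - j) + b (k + 1 - i) * b (k - 1 - j)))"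
    by (simp add: sum.distrib distrib_left)
  also have "\<dots> \<le> (\<Sum>i\<le>a. \<Sum>j\<le>a. coeff A i * coeff A j * (2 * (b (k - i) * b (k - j))))"
  proof (intro sum_mono mult_left_mono)
    fix i j assume ij: "i \<in> {..a}" "j \<in> {..a}"
    \<comment> \<open>The gap is at most \<open>a\<close>, hence the choice
      \<open>m = a * a\<close>; the bounds on \<open>k\<close> keep both indices that far from 0 and
      \<open>n\<close>.\<close>
    have "\<bar>real (k - i) - real (k - j)\<bar> \<le> real a"
      using ij a by (auto simp: of_nat_diff)
    then have "(real (k - i) - real (k - j))\<^sup>2 \<le> real (a * a)"
      using abs_le_square_iff[of "real (k - i) - real (k - j)" "real a"] by (simp add: power2_eq_square)
    moreover have "k - 1 - i = k - i - 1" "k + 1 - i = k - i + 1" "k - 1 - j = k - j - 1" "k + 1 - j = k - j + 1"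
      using ij a by auto
    ultimately show "b (k - 1 - i) * b (k + 1 - j) + b (k + 1 - i) * b (k - 1 - j) \<le> 2 * (b (k - i) * b (k - j))"
      using choose_cross_le[of "k - i" "k - j" "a * a" n] ij a by (auto simp: b_def)
  qed (auto simp: nonneg)
  also have "\<dots> = 2 * (?c k)\<^sup>2"
    using prod[of k k] a by (simp add: power2_eq_square sum_distrib_left algebra_simps)
  finally show ?thesis
    by simp
qed

section \<open>Asymptotics of the coefficients at a fixed index\<close>

lemma choose_over_power_tendsto: "(\<lambda>n. real (n choose k) / real n ^ k) \<longlonglongrightarrow> 1 / fact k"
proof (induction k)
  case 0
  show ?case by simp
next
  case (Suc k)
  have "(\<lambda>n. (1 - real k * (1 / real n)) / real (Suc k)) \<longlonglongrightarrow> (1 - real k * 0) / real (Suc k)"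
    by (intro tendsto_intros lim_1_over_n) auto
  from tendsto_mult[OF Suc this]
  have "(\<lambda>n. real (n choose k) / real n ^ k * ((1 - real k * (1 / real n)) / real (Suc k)))
    \<longlonglongrightarrow> 1 / fact (Suc k)"
    by (simp add: mult.commute)
  moreover have "\<forall>\<^sub>F n in sequentially. real (n choose k) / real n ^ k *
      ((1 - real k * (1 / real n)) / real (Suc k)) = real (n choose Suc k) / real n ^ Suc k"
    using eventually_gt_at_top[of 0]
  proof eventually_elim
    case (elim n)
    have "real (n choose Suc k) = (real n - real k) * real (n choose k) / real (Suc k)"
      using choose_Suc_mult[of k n] by (simp add: eq_divide_eq mult.commute del: binomial_Suc_Suc)
    with elim show ?case
      by (simp add: divide_simps)
  qed
  ultimately show ?case
    by (rule Lim_transform_eventually)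
qed

text \<open>The term of index \<open>i\<close> has order at most \<open>n ^ (k - i)\<close>, so only
  \<open>i = 0\<close> survives the division. At \<open>k = 0\<close> nothing damps
  \<open>B\<close>, whose constant coefficient must therefore vanish.\<close>

lemma coeff_over_power_tendsto:
  fixes A B :: "real poly"
  assumes "coeff B 0 = 0"
  shows "(\<lambda>n. coeff (A * [:1, 1:] ^ n + B) k / real n ^ k) \<longlonglongrightarrow> coeff A 0 / fact k"
proof -
  have inv0: "(\<lambda>n. (1 / real n) ^ j) \<longlonglongrightarrow> 0" if "0 < j" for j
    using tendsto_null_power[OF lim_1_over_n that] .
  have lim_term: "(\<lambda>n. real (n choose (k - i)) / real n ^ k) \<longlonglongrightarrow> (if i = 0 then 1 / fact k else 0)"
    if "i \<le> k" for i
  proof (cases "i = 0")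
    case True
    then show ?thesis
      using choose_over_power_tendsto[of k] by simp
  next
    case False
    have "(\<lambda>n. real (n choose (k - i)) / real n ^ (k - i) * (1 / real n) ^ i) \<longlonglongrightarrow> 1 / fact (k - i) * 0"
      using False by (intro tendsto_mult choose_over_power_tendsto inv0) auto
    moreover have "real (n choose (k - i)) / real n ^ (k - i) * (1 / real n) ^ i
        = real (n choose (k - i)) / real n ^ k" for n
      using that by (simp add: power_divide flip: power_add)
    ultimately show ?thesis
      using False by simp
  qed
  have "(\<lambda>n. (\<Sum>i\<le>k. coeff A i * (real (n choose (k - i)) / real n ^ k)) + coeff B k * (1 / real n) ^ k)
    \<longlonglongrightarrow> (\<Sum>i\<le>k. coeff A i * (if i = 0 then 1 / fact k else 0)) + 0"
  proof (intro tendsto_add tendsto_sum tendsto_mult tendsto_const lim_term)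
    show "(\<lambda>n. coeff B k * (1 / real n) ^ k) \<longlonglongrightarrow> 0"
      using assms by (cases "k = 0") (auto intro!: tendsto_mult_right_zero inv0 simp del: power_one_over)
  qed auto
  moreover have "(\<Sum>i\<le>k. coeff A i * (if i = 0 then 1 / fact k else 0)) = coeff A 0 / fact k"
    by (simp add: if_distrib [of "(*) _"] sum.delta cong: if_cong)
  ultimately show ?thesis
    by (simp add: coeff_mult_linear_power add_divide_distrib sum_divide_distrib power_divide)
qed

text \<open>Divided by \<open>n ^ (2 * k)\<close>, the difference of the two sides tends to
  \<open>(coeff A 0 / fact k)^2 / (k + 1) > 0\<close>. The threshold for \<open>n\<close> may depend
  on \<open>k\<close>, so this settles only finitely many \<open>k\<close> at once.\<close>

lemma eventually_log_concave_low:
  fixes A B :: "real poly"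
  assumes "coeff A 0 > 0" "coeff B 0 = 0" "1 \<le> k"
  shows "\<forall>\<^sub>F n in sequentially. coeff (A * [:1, 1:] ^ n + B) (k - 1) * coeff (A * [:1, 1:] ^ n + B) (k + 1)
    \<le> (coeff (A * [:1, 1:] ^ n + B) k)\<^sup>2"
proof -
  define c where "c n = coeff (A * [:1, 1:] ^ n + B)" for n
  have lim: "(\<lambda>n. c n l / real n ^ l) \<longlonglongrightarrow> coeff A 0 / fact l" for l
    unfolding c_def by (rule coeff_over_power_tendsto) fact
  have "(\<lambda>n. (c n k / real n ^ k)\<^sup>2 - c n (k - 1) / real n ^ (k - 1) * (c n (k + 1) / real n ^ (k + 1)))
    \<longlonglongrightarrow> (coeff A 0 / fact k)\<^sup>2 - coeff A 0 / fact (k - 1) * (coeff A 0 / fact (k + 1))"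
    by (intro tendsto_intros lim)
  moreover have "(coeff A 0 / fact k)\<^sup>2 - coeff A 0 / fact (k - 1) * (coeff A 0 / fact (k + 1)) > 0"
  proof -
    have fact: "fact (k - 1) = (fact k / real k :: real)" "fact (k + 1) = (fact k * (real k + 1) :: real)"
      using assms(3) by (simp_all add: fact_reduce[of k] mult.commute)
    have "(coeff A 0 / fact k)\<^sup>2 - coeff A 0 / fact (k - 1) * (coeff A 0 / fact (k + 1))
      = (coeff A 0 / fact k)\<^sup>2 * (1 - real k / (real k + 1))"
      unfolding fact by (simp add: power2_eq_square right_diff_distrib diff_divide_distrib mult_ac)
    also have "1 - real k / (real k + 1) = 1 / (real k + 1)"
      by (simp add: field_simps)
    also have "(coeff A 0 / fact k)\<^sup>2 * (1 / (real k + 1)) > 0"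
      using assms(1) by simp
    finally show ?thesis .
  qed
  ultimately have "\<forall>\<^sub>F n in sequentially.
      (c n k / real n ^ k)\<^sup>2 - c n (k - 1) / real n ^ (k - 1) * (c n (k + 1) / real n ^ (k + 1)) > 0"
    by (rule order_tendstoD)
  then have "\<forall>\<^sub>F n in sequentially. c n (k - 1) * c n (k + 1) \<le> (c n k)\<^sup>2"
    using eventually_gt_at_top[of 0]
  proof eventually_elim
    case (elim n)
    have "real n ^ (k - 1) * real n ^ (k + 1) = (real n ^ k)\<^sup>2"
      using assms(3) by (cases k) (simp_all add: power2_eq_square)
    then have "0 < ((c n k)\<^sup>2 - c n (k - 1) * c n (k + 1)) / (real n ^ k)\<^sup>2"
      using elim(1) by (simp add: power_divide diff_divide_distrib)
    then show ?case
      by (simp add: zero_less_divide_iff)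
  qed
  then show ?thesis
    by (simp add: c_def)
qed

lemma eventually_log_concave:
  fixes A B :: "real poly"
  assumes nonneg: "\<And>i. coeff A i \<ge> 0" and A0: "coeff A 0 > 0" and B0: "coeff B 0 = 0"
  shows "\<forall>\<^sub>F n in sequentially. \<forall>k\<ge>1.
    coeff (A * [:1, 1:] ^ n + B) (k - 1) * coeff (A * [:1, 1:] ^ n + B) (k + 1)
    \<le> (coeff (A * [:1, 1:] ^ n + B) k)\<^sup>2"
proof -
  define a where "a = degree A"
  \<comment> \<open>Large enough for three purposes: above \<open>K\<close> the middle estimate has
    its lower bound on \<open>k\<close>, \<open>B\<close> vanishes from \<open>K - 1\<close> on, and
    the indices too close to the top for the middle estimate are reversed into
    \<open>{1..K}\<close>.\<close>
  define K where "K = a * a + a + degree B + 2"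
  have "A \<noteq> 0"
    using A0 by auto
  \<comment> \<open>The constant coefficient of the reversal is the leading coefficient of
    \<open>A\<close>.\<close>
  then have "coeff (reflect_poly A) 0 > 0"
    using nonneg[of "degree A"] by (simp add: order_less_le)
  then have "\<forall>k\<in>{1..K}. \<forall>\<^sub>F n in sequentially.
      coeff (reflect_poly A * [:1, 1:] ^ n) (k - 1) * coeff (reflect_poly A * [:1, 1:] ^ n) (k + 1)
      \<le> (coeff (reflect_poly A * [:1, 1:] ^ n) k)\<^sup>2"
    using eventually_log_concave_low[of "reflect_poly A" 0] by simp
  then have "\<forall>\<^sub>F n in sequentially. \<forall>k\<in>{1..K}.
      coeff (reflect_poly A * [:1, 1:] ^ n) (k - 1) * coeff (reflect_poly A * [:1, 1:] ^ n) (k + 1)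
      \<le> (coeff (reflect_poly A * [:1, 1:] ^ n) k)\<^sup>2"
    by (simp only: eventually_ball_finite_distrib finite_atLeastAtMost)
  moreover have "\<forall>\<^sub>F n in sequentially. \<forall>k\<in>{1..K}.
    coeff (A * [:1, 1:] ^ n + B) (k - 1) * coeff (A * [:1, 1:] ^ n + B) (k + 1)
    \<le> (coeff (A * [:1, 1:] ^ n + B) k)\<^sup>2"
    using eventually_log_concave_low[OF A0 B0] by (intro eventually_ball_finite) auto
  ultimately show ?thesis
    using eventually_ge_at_top[of "2 * K"]
  proof eventually_elim
    case (elim n)
    let ?p = "A * [:1, 1:] ^ n"
    have deg: "degree ?p = a + n"
      using \<open>A \<noteq> 0\<close> by (simp add: degree_mult_eq degree_power_eq a_def)
    \<comment> \<open>The polynomial \<open>1 + x\<close> is its own reversal.\<close>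
    have "reflect_poly ?p = reflect_poly A * [:1, 1:] ^ n"
      by (simp add: reflect_poly_mult reflect_poly_power reflect_poly_pCons)
    then have reflect: "coeff (reflect_poly A * [:1, 1:] ^ n) l = coeff ?p (a + n - l)" if "l \<le> a + n" for l
      using that deg coeff_reflect_poly[of ?p l] by simp
    have B: "coeff B l = 0" if "l \<ge> K - 1" for l
      using that by (auto simp: K_def intro: coeff_eq_0)
    show ?case
    proof (intro allI impI)
      fix k :: nat
      assume "1 \<le> k"
      then consider "k \<in> {1..K}" | "K < k" "k + a * a \<le> n" | "K < k" "n < k + a * a" "k < a + n"
        | "K < k" "a + n \<le> k"
        by force
      then show "coeff (?p + B) (k - 1) * coeff (?p + B) (k + 1) \<le> (coeff (?p + B) k)\<^sup>2"
      proof cases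
        case 1
        with elim show ?thesis by blast
      next
        case 2
        then show ?thesis
          using log_concave_middle[of A k n] nonneg B by (simp add: K_def a_def)
      next
        case 3
        \<comment> \<open>Reversal sends \<open>k\<close> to its distance from the top and exchanges
          the neighbours \<open>k - 1\<close> and \<open>k + 1\<close>.\<close>
        then have "a + n - k \<in> {1..K}"
          by (auto simp: K_def)
        moreover have "a + n - (a + n - k - 1) = k + 1" "a + n - (a + n - k + 1) = k - 1"
          "a + n - (a + n - k) = k" "a + n - k + 1 \<le> a + n" "a + n - k - 1 \<le> a + n"
          using 3 by auto
        ultimately have "coeff ?p (k + 1) * coeff ?p (k - 1) \<le> (coeff ?p k)\<^sup>2"
          using elim(1) reflect by (metis diff_le_self)
        then show ?thesis
          using 3 B by (simp add: mult.commute)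
      next
        case 4
        then show ?thesis
          using B deg by (simp add: coeff_eq_0)
      qed
    qed
  qed
qed

section \<open>Independent sets after attaching pendant edges\<close>

text \<open>For the family of all independent sets of a finite graph this is the independence
  polynomial.\<close>

definition size_poly :: "'a set set \<Rightarrow> real poly"
  where "size_poly F = (\<Sum>X\<in>F. monom 1 (card X))"

lemma coeff_size_poly: "finite F \<Longrightarrow> coeff (size_poly F) t = real (card {X \<in> F. card X = t})"
  by (simp add: size_poly_def coeff_sum sum.If_cases Int_def)

lemma independent_set_empty: "independent_set H {}"
  by (simp add: independent_set_def)

lemma independent_set_subset: "independent_set H S \<Longrightarrow> T \<subseteq> S \<Longrightarrow> independent_set H T"
  unfolding independent_set_def by blast

lemma finite_independent_sets: "finite (pverts H) \<Longrightarrow> finite {S. independent_set H S \<and> P S}"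
  by (rule finite_subset[of _ "Pow (pverts H)"]) (auto simp: independent_set_def)

text \<open>Old and new vertices interact only through \<open>u\<close>, and the new ones are
  pairwise non-adjacent.\<close>

lemma independent_set_attach_pendants:
  "independent_set (attach_pendants H u m) (X <+> Y) \<longleftrightarrow>
    independent_set H X \<and> Y \<subseteq> {..<m} \<and> (u \<in> X \<longrightarrow> Y = {})"
  unfolding independent_set_def attach_pendants_def by auto blast+

lemma num_independent_sets_attach_pendants:
  assumes "finite (pverts H)"
  shows "real (num_independent_sets (attach_pendants H u m) t) =
    coeff (size_poly {X. independent_set H X \<and> u \<notin> X} * [:1, 1:] ^ m
      + size_poly {X. independent_set H X \<and> u \<in> X}) t"
proof -
  define F where "F j = {X. independent_set H X \<and> u \<notin> X \<and> card X = j}" for j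
  define F' where "F' = {X. independent_set H X \<and> u \<in> X \<and> card X = t}"
  define C where "C j = {Y. Y \<subseteq> {..<m} \<and> card Y = j}" for j
  let ?S = "{S. independent_set (attach_pendants H u m) S \<and> card S = t}"
  \<comment> \<open>The two pieces are disjoint because only the second has \<open>u\<close> in the
    old part. The union over \<open>j\<close> becomes the product with the power of
    \<open>1 + x\<close>.\<close>
  let ?T = "(\<Union>j\<le>t. F j \<times> C (t - j)) \<union> F' \<times> {{}}"
  have fin: "finite X" if "independent_set H X" for X
    using that assms by (auto simp: independent_set_def intro: finite_subset)
  have finC: "finite Y" if "Y \<subseteq> {..<m}" for Y :: "nat set"
    using that by (rule finite_subset) simp
  have finF: "finite (F j)" "finite F'" "finite (C j)" for j
    using assms by (auto simp: F_def F'_def C_def finite_independent_sets)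
  have "bij_betw (\<lambda>(X, Y). X <+> Y) ?T ?S"
  proof (rule bij_betw_imageI)
    show "inj_on (\<lambda>(X, Y). X <+> Y) ?T"
    proof (rule inj_on_inverseI[where g = "\<lambda>S. (Inl -` S, Inr -` S)"])
      have "Inl -` (X <+> Y) = X" "Inr -` (X <+> Y) = Y" for X :: "'a set" and Y :: "nat set"
        by auto
      then show "(Inl -` ((\<lambda>(X, Y). X <+> Y) Z), Inr -` ((\<lambda>(X, Y). X <+> Y) Z)) = Z"
        for Z :: "'a set \<times> nat set"
        by (cases Z) simp
    qed
    have "?S \<subseteq> (\<lambda>(X, Y). X <+> Y) ` ?T"
    proof
      fix S assume "S \<in> ?S"
      define X Y where "X = Inl -` S" and "Y = Inr -` S"
      have S: "S = X <+> Y"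
      proof (rule set_eqI)
        fix z show "z \<in> S \<longleftrightarrow> z \<in> X <+> Y"
          unfolding X_def Y_def by (cases z) auto
      qed
      have *: "independent_set H X" "Y \<subseteq> {..<m}" "u \<in> X \<Longrightarrow> Y = {}" "card S = t"
        using \<open>S \<in> ?S\<close> by (auto simp: S independent_set_attach_pendants)
      moreover have "card S = card X + card Y"
        unfolding S using * fin finC by (intro card_Plus) auto
      ultimately have "(X, Y) \<in> ?T"
        by (auto simp: F_def F'_def C_def)
      with S show "S \<in> (\<lambda>(X, Y). X <+> Y) ` ?T" by force
    qed
    moreover have "(\<lambda>(X, Y). X <+> Y) ` ?T \<subseteq> ?S"
    proof (rule image_subsetI)
      show "(\<lambda>(X, Y). X <+> Y) Z \<in> ?S" if "Z \<in> ?T" for Z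
        using that fin finC
        by (auto simp: F_def F'_def C_def independent_set_attach_pendants card_Plus)
    qed
    ultimately show "(\<lambda>(X, Y). X <+> Y) ` ?T = ?S"
      by (rule subset_antisym[rotated])
  qed
  then have "num_independent_sets (attach_pendants H u m) t = card ?T"
    unfolding num_independent_sets_def by (rule bij_betw_same_card[symmetric])
  also have "\<dots> = card (\<Union>j\<le>t. F j \<times> C (t - j)) + card (F' \<times> {{} :: nat set})"
    using finF by (intro card_Un_disjoint) (auto simp: F_def F'_def)
  also have "card (\<Union>j\<le>t. F j \<times> C (t - j)) = (\<Sum>j\<le>t. card (F j \<times> C (t - j)))"
    using finF by (intro card_UN_disjoint) (auto simp: F_def)
  finally show ?thesis
    using assms
    by (simp add: card_cartesian_product n_subsets coeff_mult_linear_power coeff_size_poly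
        finite_independent_sets F_def F'_def C_def conj_assoc)
qed

section \<open>From log-concavity to unimodality\<close>

text \<open>Positivity allows cancellation in the log-concavity inequality, so once the sequence
  fails to increase strictly it never rises again.\<close>

lemma unimodal_if_log_concave:
  assumes "log_concave_seq a n" and pos: "\<And>k. k \<le> n \<Longrightarrow> a k > 0"
  shows "unimodal_seq a n"
proof -
  have descend: "a (Suc (Suc k)) \<le> a (Suc k)" if "a (Suc k) \<le> a k" "Suc k < n" for k
  proof -
    have "a k * a (Suc (Suc k)) \<le> a (Suc k) * a (Suc k)"
      using assms(1) that(2) unfolding log_concave_seq_def
      by (auto dest: spec[of _ "Suc k"] simp: power2_eq_square)
    also have "\<dots> \<le> a k * a (Suc k)"
      using that pos[of "Suc k"] by (intro mult_right_mono) auto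
    finally show ?thesis
      using pos[of k] that by simp
  qed
  \<comment> \<open>The peak is the first index not followed by a larger term; the alternative
    \<open>m = n\<close> guarantees that one exists.\<close>
  define m where "m = (LEAST m. m = n \<or> a (Suc m) \<le> a m)"
  have m: "m = n \<or> a (Suc m) \<le> a m"
    unfolding m_def by (rule LeastI[of _ n]) simp
  have "m \<le> n"
    unfolding m_def by (rule Least_le) simp
  moreover have "a k \<le> a (k + 1)" if "k < m" for k
    using not_less_Least[of k "\<lambda>m. m = n \<or> a (Suc m) \<le> a m"] that by (auto simp: m_def)
  moreover have "a (Suc k) \<le> a k" if "m \<le> k" "k < n" for k
    using that
  proof (induction k rule: dec_induct)
    case base
    with m show ?case by simp
  next
    case (step k)
    then show ?case
      using descend by simp
  qed
  ultimately show ?thesis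
    unfolding unimodal_seq_def by auto
qed

text \<open>Subsets of a maximum independent set are independent and take every smaller
  size.\<close>

lemma num_independent_sets_pos:
  assumes "finite (pverts H)" "t \<le> independence_number H"
  shows "num_independent_sets H t > 0"
proof -
  have "independence_number H \<in> card ` {S. independent_set H S}"
    unfolding independence_number_def
    using finite_independent_sets[OF assms(1), of "\<lambda>_. True"] independent_set_empty
    by (intro Max_in) auto
  then obtain S where S: "independent_set H S" "t \<le> card S"
    using assms(2) by auto
  then obtain T where "T \<subseteq> S" "card T = t"
    by (meson obtain_subset_with_card_n)
  then have "{S. independent_set H S \<and> card S = t} \<noteq> {}"
    using S independent_set_subset by blast
  then show ?thesis
    unfolding num_independent_sets_def using finite_independent_sets[OF assms(1)] by (simp add: card_gt_0_iff)
qed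

lemma unimodal_independent_set_seq_if_log_concave:
  "finite (pverts H) \<Longrightarrow> log_concave_independent_set_seq H \<Longrightarrow> unimodal_independent_set_seq H"
  unfolding log_concave_independent_set_seq_def unimodal_independent_set_seq_def
  by (rule unimodal_if_log_concave) (simp_all add: num_independent_sets_pos)

lemma finite_pverts_attach_pendants: "finite (pverts H) \<Longrightarrow> finite (pverts (attach_pendants H u m))"
  by (simp add: attach_pendants_def)

section \<open>Application to attached stars\<close>

lemma eventually_log_concave_attach_pendants:
  assumes fin: "finite (pverts H)"
  shows "\<forall>\<^sub>F m in sequentially. log_concave_independent_set_seq (attach_pendants H u m)"
proof -
  \<comment> \<open>Finiteness matters here, since infinite sets also have \<open>card\<close>
    0.\<close>
  have "{X. (independent_set H X \<and> u \<notin> X) \<and> card X = 0} = {{}}"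
    using fin by (auto simp: independent_set_def dest: finite_subset)
  then have "coeff (size_poly {X. independent_set H X \<and> u \<notin> X}) 0 > 0"
    using fin by (simp add: coeff_size_poly finite_independent_sets)
  moreover have "{X. (independent_set H X \<and> u \<in> X) \<and> card X = 0} = {}"
    using fin by (auto simp: independent_set_def dest: finite_subset)
  then have "coeff (size_poly {X. independent_set H X \<and> u \<in> X}) 0 = 0"
    using fin by (simp add: coeff_size_poly finite_independent_sets)
  moreover have "coeff (size_poly {X. independent_set H X \<and> u \<notin> X}) i \<ge> 0" for i
    using fin by (simp add: coeff_size_poly finite_independent_sets)
  ultimately have "\<forall>\<^sub>F m in sequentially. \<forall>k\<ge>1.
      real (num_independent_sets (attach_pendants H u m) (k - 1))
        * real (num_independent_sets (attach_pendants H u m) (k + 1))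
      \<le> (real (num_independent_sets (attach_pendants H u m) k))\<^sup>2"
    unfolding num_independent_sets_attach_pendants[OF fin] by (intro eventually_log_concave)
  then show ?thesis
    unfolding log_concave_independent_set_seq_def log_concave_seq_def
    by (rule eventually_mono) blast
qed

theorem theorem1p11:
  fixes G :: "'a pair_pre_digraph"
  assumes "pair_graph G"
  shows "\<exists>N::nat. \<forall>v \<in> pverts G. \<forall>n::nat. 1 \<le> n \<and> N \<le> n \<longrightarrow>
    log_concave_independent_set_seq (attach_star_at_center G v n) \<and>
    unimodal_independent_set_seq (attach_star_at_center G v n) \<and>
    log_concave_independent_set_seq (attach_star_at_leaf G v n) \<and>
    unimodal_independent_set_seq (attach_star_at_leaf G v n)"
proof -
  interpret pair_graph G by fact
  have fin: "finite (pverts G)"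
    by (rule finite_verts)
  let ?LC = "\<lambda>v n. log_concave_independent_set_seq (attach_star_at_center G v n) \<and>
    log_concave_independent_set_seq (attach_star_at_leaf G v n)"
  have "\<forall>\<^sub>F n in sequentially. ?LC v n" for v
  proof (rule eventually_conj)
    show "\<forall>\<^sub>F n in sequentially. log_concave_independent_set_seq (attach_star_at_center G v n)"
      unfolding attach_star_at_center_def by (rule eventually_log_concave_attach_pendants) fact
    \<comment> \<open>One of the \<open>n\<close> leaves is \<open>v\<close> itself, so the center
      receives only \<open>n - 1\<close> pendant edges.\<close>
    have "filterlim (\<lambda>n. n - 1) sequentially sequentially"
      by (rule filterlim_minus_const_nat_at_top)
    then show "\<forall>\<^sub>F n in sequentially. log_concave_independent_set_seq (attach_star_at_leaf G v n)"
      unfolding attach_star_at_leaf_def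
      by (rule eventually_compose_filterlim[rotated])
        (intro eventually_log_concave_attach_pendants finite_pverts_attach_pendants fin)
  qed
  \<comment> \<open>As there are finitely many vertices \<open>v\<close>, one threshold serves them
    all.\<close>
  then have "\<forall>\<^sub>F n in sequentially. \<forall>v\<in>pverts G. ?LC v n"
    using fin by (simp add: eventually_ball_finite)
  then obtain N where N: "\<forall>n\<ge>N. \<forall>v\<in>pverts G. ?LC v n"
    unfolding eventually_sequentially by blast
  have "finite (pverts (attach_star_at_center G v n))" "finite (pverts (attach_star_at_leaf G v n))" for v n
    unfolding attach_star_at_center_def attach_star_at_leaf_def
    by (intro finite_pverts_attach_pendants fin)+
  with N show ?thesis
    by (intro exI[of _ N]) (simp add: unimodal_independent_set_seq_if_log_concave)
qed

end
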